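(* Let $0<q<1$, $\lambda\in\mathbb{R}$, and let $a,b,x$ be nonzero complex numbers such that for every integer $m\ge 0$ none of $$aq^{m+1},\ bq^{m+1},\ aq^{\lambda+m+1},\ bq^{\lambda+m+1},\ xq^m,\ \tfrac{x}{a}q^m,\ \tfrac{x}{b}q^m,\ \tfrac{x}{a}q^{m-\lambda},\ \tfrac{x}{b}q^{m-\lambda}$$ equals $1$. Define the fractional Big $q$-Laguerre function by $$P_{\lambda}(x;a,b;q)=\frac{a^\lambda b^\lambda q^{\lambda(\lambda+1)}(1-q)^\lambda\left(x;q\right)_{\infty}}{(aq,bq;q)_\lambda\left(\frac{x}{a},\frac{x}{b};q\right)_{\infty}}\,D_q^{\lambda}\left[\frac{\left(\frac{x}{aq^{\lambda}},\frac{x}{bq^{\lambda}};q\right)_{\infty}}{\left(x;q\right)_{\infty}}\right],$$ where $D_q^\lambda$ acts in the variable $x$. Then $$P_{\lambda}(x;a,b;q)=\frac{a^\lambda b^\lambda q^{\lambda(\lambda+1)}x^{-\lambda}}{(aq,bq;q)_\lambda\left(\frac{x}{a},\frac{x}{b};q\right)_{-\lambda}}\;{}_3\phi_2\!\left(\begin{matrix}q^{-\lambda},\,x,\,0\\ \frac{x}{a}q^{-\lambda},\,\frac{x}{b}q^{-\lambda}\end{matrix}\,\middle|\,q;q\right).$$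
   Context: Notation: $(s;q)_n=\prod_{j=0}^{n-1}(1-sq^j)$, $(s;q)_\infty=\prod_{j=0}^\infty(1-sq^j)$, and for any real $\mu$, $(s;q)_\mu=\frac{(s;q)_\infty}{(sq^\mu;q)_\infty}$; $(s_1,\dots,s_r;q)_\mu=\prod_i(s_i;q)_\mu$ for $\mu$ an integer, $\infty$ or real. Powers with real exponent take principal values. The basic hypergeometric series is $${}_3\phi_2\!\left(\begin{matrix}a_1,a_2,a_3\\ b_1,b_2\end{matrix}\,\middle|\,q;z\right)=\sum_{n=0}^\infty\frac{(a_1,a_2,a_3;q)_n}{(b_1,b_2;q)_n}\frac{z^n}{(q;q)_n}.$$ The fractional $q$-derivative of order $\lambda$ is $$(D_q^{\lambda}f)(x)=\frac{1}{x^{\lambda}(1-q)^{\lambda}}\sum_{n=0}^{\infty}\frac{(q^{-\lambda};q)_n}{(q;q)_n}q^n f(q^n x).$$ *)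

theory Defs
  imports "HOL-Analysis.Analysis"
begin

text \<open>
  The base q is a real number, used only for 0 < q < 1, and the remaining parameters are complex.
  Powers of q and of 1 - q are therefore real powers of positive numbers, embedded into the complex
  numbers; powers of complex numbers are complex \<open>powr\<close>, i.e. principal values.
\<close>

definition qpoch :: "complex \<Rightarrow> real \<Rightarrow> nat \<Rightarrow> complex" where
  "qpoch s q n = (\<Prod>j<n. 1 - s * of_real q ^ j)"

definition qpoch_inf :: "complex \<Rightarrow> real \<Rightarrow> complex" where
  "qpoch_inf s q = (\<Prod>j. 1 - s * of_real q ^ j)"

definition qpoch_real :: "complex \<Rightarrow> real \<Rightarrow> real \<Rightarrow> complex" where
  "qpoch_real s q \<mu> = qpoch_inf s q / qpoch_inf (s * of_real (q powr \<mu>)) q"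

definition phi32 ::
    "complex \<Rightarrow> complex \<Rightarrow> complex \<Rightarrow> complex \<Rightarrow> complex \<Rightarrow> real \<Rightarrow> complex \<Rightarrow> complex" where
  "phi32 a1 a2 a3 b1 b2 q z =
     (\<Sum>n. (qpoch a1 q n * qpoch a2 q n * qpoch a3 q n) / (qpoch b1 q n * qpoch b2 q n)
           * (z ^ n / qpoch (of_real q) q n))"

definition frac_qderiv :: "real \<Rightarrow> real \<Rightarrow> (complex \<Rightarrow> complex) \<Rightarrow> complex \<Rightarrow> complex" where
  "frac_qderiv q lam f x =
     1 / (x powr of_real lam * of_real ((1 - q) powr lam)) *
     (\<Sum>n. qpoch (of_real (q powr (-lam))) q n / qpoch (of_real q) q n
           * of_real q ^ n * f (of_real q ^ n * x))"

definition frac_big_q_Laguerre ::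
    "real \<Rightarrow> complex \<Rightarrow> complex \<Rightarrow> complex \<Rightarrow> real \<Rightarrow> complex" where
  "frac_big_q_Laguerre lam x a b q =
     (a powr of_real lam * b powr of_real lam * of_real (q powr (lam * (lam + 1)))
        * of_real ((1 - q) powr lam) * qpoch_inf x q)
     / (qpoch_real (a * of_real q) q lam * qpoch_real (b * of_real q) q lam
        * (qpoch_inf (x / a) q * qpoch_inf (x / b) q))
     * frac_qderiv q lam
         (\<lambda>t. qpoch_inf (t / (a * of_real (q powr lam))) q * qpoch_inf (t / (b * of_real (q powr lam))) q
              / qpoch_inf t q) x"

end

theory Submission
  imports Defs
begin

text \<open>Splitting off the first n factors gives (s q^n; q)_inf = (s; q)_inf / (s; q)_n. Hence
  the function under the fractional derivative, evaluated at q^n x, is its value at x times (x; q)_n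
  / (y1, y2; q)_n, where y1 = (x/a) q^(-lam) and y2 = (x/b) q^(-lam). Since (0; q)_n = 1, the series
  defining D_q^lam is then this constant value times the 3phi2 series, termwise. In the prefactor
  (1-q)^lam and (x; q)_inf cancel, and the remaining infinite products combine into (x/a, x/b;
  q)_(-lam). The splitting is \<open>qpoch_inf_eq_qpoch_mult\<close>; \<open>summable_phi32\<close>
  supplies the convergence needed to pull the constant out of the sum.\<close>

lemma convergent_prod_qpoch:
  fixes s :: complex
  assumes "\<bar>q\<bar> < 1"
  shows "convergent_prod (\<lambda>j. 1 - s * of_real q ^ j)"
proof (rule abs_convergent_prod_imp_convergent_prod)
  have "summable (\<lambda>j. norm s * \<bar>q\<bar> ^ j)"
    using assms by (intro summable_mult summable_geometric) auto
  then show "abs_convergent_prod (\<lambda>j. 1 - s * of_real q ^ j)"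
    by (simp add: abs_convergent_prod_conv_summable norm_mult norm_power)
qed

lemma qpoch_tendsto_qpoch_inf:
  assumes "\<bar>q\<bar> < 1"
  shows "qpoch s q \<longlonglongrightarrow> qpoch_inf s q"
proof -
  have "(\<lambda>n. \<Prod>j\<le>n. 1 - s * of_real q ^ j) \<longlonglongrightarrow> qpoch_inf s q"
    unfolding qpoch_inf_def by (intro convergent_prod_LIMSEQ convergent_prod_qpoch assms)
  \<comment> \<open>The partial product over j \<le> n has n + 1 factors, hence the index
    shift.\<close>
  then have "(\<lambda>n. qpoch s q (Suc n)) \<longlonglongrightarrow> qpoch_inf s q"
    by (simp add: qpoch_def lessThan_Suc_atMost)
  then show ?thesis
    by (rule LIMSEQ_imp_Suc)
qed

lemma qpoch_nonzero:
  assumes "\<And>j. s * of_real q ^ j \<noteq> 1"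
  shows "qpoch s q n \<noteq> 0"
  using assms by (auto simp: qpoch_def eq_commute[of "1 :: complex"])

lemma qpoch_inf_nonzero:
  assumes "\<bar>q\<bar> < 1" and "\<And>j. s * of_real q ^ j \<noteq> 1"
  shows "qpoch_inf s q \<noteq> 0"
  unfolding qpoch_inf_def
  using assms(2) by (intro prodinf_nonzero convergent_prod_qpoch assms(1)) (metis eq_iff_diff_eq_0)

text \<open>The finite splitting of m + n factors follows by induction on m; both sides then pass to
  the limit in m.\<close>

lemma qpoch_inf_eq_qpoch_mult:
  assumes "\<bar>q\<bar> < 1"
  shows "qpoch_inf s q = qpoch s q n * qpoch_inf (of_real q ^ n * s) q"
proof (rule LIMSEQ_unique)
  have "qpoch s q (m + n) = qpoch s q n * qpoch (of_real q ^ n * s) q m" for m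
    by (induction m) (simp_all add: qpoch_def power_add mult_ac)
  moreover have "(\<lambda>m. qpoch s q n * qpoch (of_real q ^ n * s) q m)
      \<longlonglongrightarrow> qpoch s q n * qpoch_inf (of_real q ^ n * s) q"
    by (intro tendsto_mult_left qpoch_tendsto_qpoch_inf assms)
  ultimately show "(\<lambda>m. qpoch s q (m + n)) \<longlonglongrightarrow> qpoch s q n * qpoch_inf (of_real q ^ n * s) q"
    by simp
  show "(\<lambda>m. qpoch s q (m + n)) \<longlonglongrightarrow> qpoch_inf s q"
    by (intro LIMSEQ_ignore_initial_segment qpoch_tendsto_qpoch_inf assms)
qed

text \<open>The coefficient of z^n converges, being a quotient of finite products whose denominators
  have nonzero limits. It is therefore bounded, and a geometric series in \<open>norm z\<close>
  dominates.\<close>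

lemma summable_phi32:
  assumes q: "\<bar>q\<bar> < 1" and z: "norm z < 1"
    and b1: "\<And>j. b1 * of_real q ^ j \<noteq> 1" and b2: "\<And>j. b2 * of_real q ^ j \<noteq> 1"
  shows "summable (\<lambda>n. (qpoch a1 q n * qpoch a2 q n * qpoch a3 q n) / (qpoch b1 q n * qpoch b2 q n)
           * (z ^ n / qpoch (of_real q) q n))"
proof -
  let ?c = "\<lambda>n. (qpoch a1 q n * qpoch a2 q n * qpoch a3 q n)
                / (qpoch b1 q n * qpoch b2 q n * qpoch (of_real q) q n)"
  \<comment> \<open>No factor 1 - q^(j+1) vanishes, so the limit of (q; q)_n is nonzero.\<close>
  have "norm (complex_of_real q * of_real q ^ j) < 1" for j
    using power_Suc_less_one[of "\<bar>q\<bar>" j] q power_less_one_iff[of "\<bar>q\<bar>" "Suc j"]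
    by (simp add: norm_mult norm_power)
  then have "qpoch_inf (of_real q) q \<noteq> 0"
    using q by (intro qpoch_inf_nonzero) (assumption, metis norm_one less_irrefl)
  then have "?c \<longlonglongrightarrow> (qpoch_inf a1 q * qpoch_inf a2 q * qpoch_inf a3 q)
                / (qpoch_inf b1 q * qpoch_inf b2 q * qpoch_inf (of_real q) q)"
    using q b1 b2
    by (intro tendsto_divide tendsto_mult qpoch_tendsto_qpoch_inf) (simp_all add: qpoch_inf_nonzero)
  then have "Bseq ?c"
    by (intro convergent_imp_Bseq convergentI)
  then obtain K where K: "\<And>n. norm (?c n) \<le> K"
    by (auto elim!: BseqE)
  have "summable (\<lambda>n. K * norm z ^ n)"
    using z by (intro summable_mult summable_geometric) auto
  then have "summable (\<lambda>n. ?c n * z ^ n)"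
    by (rule summable_comparison_test'[where N = 0])
       (simp only: norm_mult norm_power, intro mult_right_mono K zero_le_power norm_ge_zero)
  then show ?thesis
    by (simp add: field_simps)
qed

theorem proposition8:
  fixes q lam :: real and a b x :: complex
  assumes "0 < q" and "q < 1"
    and "a \<noteq> 0" and "b \<noteq> 0" and "x \<noteq> 0"
    and "\<And>m::nat. a * of_real q ^ (m + 1) \<noteq> 1"
    and "\<And>m::nat. b * of_real q ^ (m + 1) \<noteq> 1"
    and "\<And>m::nat. a * of_real (q powr (lam + real m + 1)) \<noteq> 1"
    and "\<And>m::nat. b * of_real (q powr (lam + real m + 1)) \<noteq> 1"
    and "\<And>m::nat. x * of_real q ^ m \<noteq> 1"
    and "\<And>m::nat. x / a * of_real q ^ m \<noteq> 1"
    and "\<And>m::nat. x / b * of_real q ^ m \<noteq> 1"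
    and "\<And>m::nat. x / a * of_real (q powr (real m - lam)) \<noteq> 1"
    and "\<And>m::nat. x / b * of_real (q powr (real m - lam)) \<noteq> 1"
  shows "frac_big_q_Laguerre lam x a b q =
     (a powr of_real lam * b powr of_real lam * of_real (q powr (lam * (lam + 1)))
        * x powr (- of_real lam))
     / (qpoch_real (a * of_real q) q lam * qpoch_real (b * of_real q) q lam
        * (qpoch_real (x / a) q (-lam) * qpoch_real (x / b) q (-lam)))
     * phi32 (of_real (q powr (-lam))) x 0
         (x / a * of_real (q powr (-lam))) (x / b * of_real (q powr (-lam))) q (of_real q)"
proof -
  have q: "\<bar>q\<bar> < 1"
    using assms(1,2) by simp
  define y1 where "y1 = x / a * of_real (q powr (-lam))"
  define y2 where "y2 = x / b * of_real (q powr (-lam))"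
  define f where "f = (\<lambda>t. qpoch_inf (t / (a * of_real (q powr lam))) q
    * qpoch_inf (t / (b * of_real (q powr lam))) q / qpoch_inf t q)"
  define T where "T = (\<lambda>n. (qpoch (of_real (q powr (-lam))) q n * qpoch x q n * qpoch 0 q n)
    / (qpoch y1 q n * qpoch y2 q n) * (of_real q ^ n / qpoch (of_real q) q n))"
  \<comment> \<open>This is the value of \<open>f\<close> at x, the common factor of all sampled
    values.\<close>
  define C where "C = qpoch_inf y1 q * qpoch_inf y2 q / qpoch_inf x q"
  \<comment> \<open>Turns the hypotheses with exponent m - lam into the statement that the lower
    parameters \<open>y1\<close>, \<open>y2\<close> produce no zero factor.\<close>
  have shift: "q powr (real m - lam) = q powr (-lam) * q ^ m" for m
    using assms(1) by (simp add: powr_diff powr_minus powr_realpow field_simps)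
  have y1: "y1 * of_real q ^ m \<noteq> 1" and y2: "y2 * of_real q ^ m \<noteq> 1" for m
    using assms(13,14)[of m] by (simp_all add: shift y1_def y2_def mult.assoc)
  have x: "qpoch_inf x q \<noteq> 0" and y: "qpoch_inf y1 q \<noteq> 0" "qpoch_inf y2 q \<noteq> 0"
    using q assms(10) y1 y2 by (simp_all add: qpoch_inf_nonzero)
  have tail: "qpoch_inf (of_real q ^ n * s) q = qpoch_inf s q / qpoch s q n"
    if "\<And>j. s * of_real q ^ j \<noteq> 1" for s n
    using qpoch_inf_eq_qpoch_mult[OF q, of s n] qpoch_nonzero[of s q n] that by simp
  have "f (of_real q ^ n * x)
      = qpoch_inf (of_real q ^ n * y1) q * qpoch_inf (of_real q ^ n * y2) q
        / qpoch_inf (of_real q ^ n * x) q" for n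
    by (simp add: f_def y1_def y2_def powr_minus divide_simps)
  then have "f (of_real q ^ n * x) = C * (qpoch x q n / (qpoch y1 q n * qpoch y2 q n))" for n
    using y1 y2 assms(10) by (simp add: tail C_def)
  moreover have "qpoch 0 q n = 1" for n
    by (simp add: qpoch_def)
  ultimately have "qpoch (of_real (q powr (-lam))) q n / qpoch (of_real q) q n * of_real q ^ n
      * f (of_real q ^ n * x) = C * T n" for n
    by (simp add: T_def mult_ac)
  moreover have "summable T"
    unfolding T_def using y1 y2 q by (intro summable_phi32) auto
  ultimately have D: "frac_qderiv q lam f x
      = 1 / (x powr of_real lam * of_real ((1 - q) powr lam)) * (C * suminf T)"
    by (simp add: frac_qderiv_def suminf_mult)
  have phi: "phi32 (of_real (q powr (-lam))) x 0 y1 y2 q (of_real q) = suminf T"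
    by (simp add: phi32_def T_def)
  have r: "qpoch_real (x / a) q (-lam) = qpoch_inf (x / a) q / qpoch_inf y1 q"
    "qpoch_real (x / b) q (-lam) = qpoch_inf (x / b) q / qpoch_inf y2 q"
    by (simp_all add: qpoch_real_def y1_def y2_def)
  \<comment> \<open>The prefactor computation with opaque letters: c is (1-q)^lam, X is (x; q)_inf,
    y and z are the infinite products at \<open>y1\<close> and \<open>y2\<close>, u and v those at
    x/a and x/b, p is x^lam and S the series.\<close>
  have cancel: "A * c * X / (D * (u * v)) * (1 / (p * c) * (y * z / X * S))
      = A * inverse p / (D * (u / y * (v / z))) * S"
    if "c \<noteq> 0" "X \<noteq> 0" "y \<noteq> 0" "z \<noteq> 0" for A c X D u v p y z S :: complex
    using that by (simp add: field_simps)
  have "complex_of_real ((1 - q) powr lam) \<noteq> 0"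
    using assms(2) by simp
  moreover have "x powr (- of_real lam) = inverse (x powr of_real lam)"
    by (rule powr_minus)
  ultimately show ?thesis
    using cancel[OF _ x y]
    by (simp only: frac_big_q_Laguerre_def f_def[symmetric] y1_def[symmetric] y2_def[symmetric]
        D phi r C_def not_False_eq_True)
qed

end
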